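(* Let $r \ge 1$ be an integer and let $\mathfrak{g} = V_1 \oplus \cdots \oplus V_r$ be a graded real Lie algebra of length $r$, where each $V_i$ is equipped with a Euclidean norm $\|\cdot\|_i$. For $X = (v_1, \dots, v_r) \in \mathfrak{g}$ with $v_i \in V_i$, define $$\|X\| = \left(\|v_1\|_1^{2r} + \|v_2\|_2^{2r-2} + \cdots + \|v_r\|_r^{2}\right)^{1/(2r)} = \left(\sum_{i=1}^{r} \|v_i\|_i^{2(r-i+1)}\right)^{1/(2r)}.$$ Then for all $X, Y \in \mathfrak{g}$, $$\|X + Y\| \le \|X\| + \|Y\|.$$
   Context: A real Lie algebra $\mathfrak{g}$ is called graded if there is a finite family of subspaces $V_1, \dots, V_r$ with $\mathfrak{g} = V_1 \oplus \cdots \oplus V_r$ satisfying $[V_i, V_j] \subseteq V_{i+j}$ for all $i, j$, where $V_k = 0$ if $k > r$. The integer $r$ is its length. A Euclidean norm on $V_i$ is the norm induced by an inner product on the real vector space $V_i$. Elements of $\mathfrak{g}$ are written as tuples $(v_1, \dots, v_r)$ with $v_i \in V_i$, and addition is componentwise. *)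

theory Defs
  imports "HOL-Analysis.Analysis"
begin

locale real_lie_algebra =
  fixes bracket :: "'a::real_vector \<Rightarrow> 'a \<Rightarrow> 'a"
  assumes bilinear_bracket: "bilinear bracket"
    and bracket_self: "bracket x x = 0"
    and jacobi: "bracket x (bracket y z) + bracket y (bracket z x) + bracket z (bracket x y) = 0"

text \<open>The summands are indexed by \<^term>\<open>{1..r}\<close>; functions are taken in the extensional
  product so that the tuple of components is literally unique. Values of \<^term>\<open>V\<close> at
  other indices are irrelevant.\<close>

definition internal_direct_sum :: "nat \<Rightarrow> (nat \<Rightarrow> 'a::real_vector set) \<Rightarrow> bool" where
  "internal_direct_sum r V \<longleftrightarrow>
    (\<forall>i\<in>{1..r}. subspace (V i)) \<and>
    (\<forall>x. \<exists>!v. v \<in> Pi\<^sub>E {1..r} V \<and> x = (\<Sum>i=1..r. v i))"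

definition component :: "nat \<Rightarrow> (nat \<Rightarrow> 'a::real_vector set) \<Rightarrow> 'a \<Rightarrow> nat \<Rightarrow> 'a" where
  "component r V x = (THE v. v \<in> Pi\<^sub>E {1..r} V \<and> x = (\<Sum>i=1..r. v i))"

locale graded_lie_algebra = real_lie_algebra bracket
  for bracket :: "'a::real_vector \<Rightarrow> 'a \<Rightarrow> 'a" +
  fixes r :: nat and V :: "nat \<Rightarrow> 'a set"
  assumes direct_sum: "internal_direct_sum r V"
    and bracket_grading: "\<lbrakk>i \<in> {1..r}; j \<in> {1..r}; x \<in> V i; y \<in> V j\<rbrakk>
      \<Longrightarrow> bracket x y \<in> (if i + j \<le> r then V (i + j) else {0})"

text \<open>The class \<^class>\<open>real_inner\<close> puts an inner product on a whole type; here
  each summand carries its own.\<close>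

definition inner_product_on :: "'a::real_vector set \<Rightarrow> ('a \<Rightarrow> 'a \<Rightarrow> real) \<Rightarrow> bool" where
  "inner_product_on W ip \<longleftrightarrow>
    (\<forall>x\<in>W. \<forall>y\<in>W. ip x y = ip y x) \<and>
    (\<forall>x\<in>W. \<forall>y\<in>W. \<forall>z\<in>W. ip (x + y) z = ip x z + ip y z) \<and>
    (\<forall>c. \<forall>x\<in>W. \<forall>y\<in>W. ip (c *\<^sub>R x) y = c * ip x y) \<and>
    (\<forall>x\<in>W. x \<noteq> 0 \<longrightarrow> ip x x > 0)"

definition euclidean_norm_on :: "'a::real_vector set \<Rightarrow> ('a \<Rightarrow> real) \<Rightarrow> bool" where
  "euclidean_norm_on W N \<longleftrightarrow>
    (\<exists>ip. inner_product_on W ip \<and> (\<forall>x\<in>W. N x = sqrt (ip x x)))"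

definition graded_norm ::
  "nat \<Rightarrow> (nat \<Rightarrow> 'a::real_vector set) \<Rightarrow> (nat \<Rightarrow> 'a \<Rightarrow> real) \<Rightarrow> 'a \<Rightarrow> real" where
  "graded_norm r V N x =
    root (2 * r) (\<Sum>i=1..r. N i (component r V x i) ^ (2 * (r - i + 1)))"

lemma component_eqI:
  assumes "internal_direct_sum r V" "v \<in> Pi\<^sub>E {1..r} V"
  shows "component r V (\<Sum>i=1..r. v i) = v"
  unfolding component_def
proof (rule the1_equality)
  show "\<exists>!w. w \<in> Pi\<^sub>E {1..r} V \<and> (\<Sum>i=1..r. v i) = (\<Sum>i=1..r. w i)"
    using assms(1) unfolding internal_direct_sum_def by blast
  show "v \<in> Pi\<^sub>E {1..r} V \<and> (\<Sum>i=1..r. v i) = (\<Sum>i=1..r. v i)"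
    using assms(2) by simp
qed

end

theory Submission
  imports Defs
begin

text \<open>
  The degree-\<open>i\<close> summand enters the graded norm with exponent \<open>2 n\<close>, where
  \<open>n = r - i + 1\<close> lies between \<open>1\<close> and \<open>r\<close>. Writing \<open>\<parallel>v\<parallel> ^ (2 n) = u ^ (2 r)\<close> with
  \<open>u = \<parallel>v\<parallel> ^ (n / r)\<close> turns the graded norm into an ordinary \<open>l\<^sup>p\<close> norm, \<open>p = 2 r\<close>, of the
  vector of the \<open>u\<close>. Since \<open>n / r \<le> 1\<close>, the function \<open>t \<mapsto> t ^ (n / r)\<close> is monotone
  and subadditive on \<open>t \<ge> 0\<close> (\<open>root_power_add_le\<close>), so the vector belonging to
  \<open>X + Y\<close> is dominated entrywise by the sum of those belonging to \<open>X\<close> and \<open>Y\<close>. Minkowski's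
  inequality for finite sums (\<open>Minkowski_inequality_sum\<close>) then finishes the argument
  (\<open>root_sum_power_add_le\<close>).

  What links this to \<open>X\<close> and \<open>Y\<close> is linear: components are additive, and \<open>N i\<close>
  satisfies the triangle inequality on \<open>V i\<close> by the Cauchy-Schwarz inequality for the
  inner product that induces it.
\<close>

section \<open>Norms induced by an inner product on a subspace\<close>

lemma inner_product_on_commute:
  assumes "inner_product_on W ip" "x \<in> W" "y \<in> W"
  shows "ip x y = ip y x"
proof -
  have "\<forall>x\<in>W. \<forall>y\<in>W. ip x y = ip y x"
    using assms(1) unfolding inner_product_on_def by (rule conjunct1)
  with assms(2,3) show ?thesis by blast
qed

lemma inner_product_on_add_left:
  assumes "inner_product_on W ip" "x \<in> W" "y \<in> W" "z \<in> W"
  shows "ip (x + y) z = ip x z + ip y z"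
proof -
  have "\<forall>x\<in>W. \<forall>y\<in>W. \<forall>z\<in>W. ip (x + y) z = ip x z + ip y z"
    using assms(1) unfolding inner_product_on_def by (elim conjE)
  with assms(2-4) show ?thesis by blast
qed

lemma inner_product_on_ge_zero:
  assumes "inner_product_on W ip" "x \<in> W"
  shows "ip x x \<ge> 0"
proof (cases "x = 0")
  case True
  have "ip (0 *\<^sub>R x) x = 0 * ip x x"
    using assms unfolding inner_product_on_def by blast
  with True show ?thesis by simp
next
  case False
  with assms show ?thesis unfolding inner_product_on_def by fastforce
qed

text \<open>Expanding the inner product of \<open>\<langle>y,y\<rangle> x - \<langle>x,y\<rangle> y\<close> with itself gives
  \<open>\<langle>y,y\<rangle> (\<langle>x,x\<rangle> \<langle>y,y\<rangle> - \<langle>x,y\<rangle>\<^sup>2)\<close>, which is nonnegative.\<close>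

lemma inner_product_on_Cauchy_Schwarz:
  assumes ip: "inner_product_on W ip" and W: "subspace W" and x: "x \<in> W" and y: "y \<in> W"
  shows "(ip x y)\<^sup>2 \<le> ip x x * ip y y"
proof -
  note comm = inner_product_on_commute[OF ip] and add = inner_product_on_add_left[OF ip]
  have scale: "\<And>c u v. u \<in> W \<Longrightarrow> v \<in> W \<Longrightarrow> ip (c *\<^sub>R u) v = c * ip u v"
    and pos: "\<And>u. u \<in> W \<Longrightarrow> u \<noteq> 0 \<Longrightarrow> ip u u > 0"
    using ip unfolding inner_product_on_def by blast+
  show ?thesis
  proof (cases "y = 0")
    case True
    have "ip x y = 0"
      using scale[of y x 0] comm[OF x y] x y True by simp
    moreover have "ip y y = 0"
      using scale[of y y 0] y True by simp
    ultimately show ?thesis by simp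
  next
    case False
    define z where "z = ip y y *\<^sub>R x + (- ip x y) *\<^sub>R y"
    have mem: "ip y y *\<^sub>R x \<in> W" "(- ip x y) *\<^sub>R y \<in> W"
      using W x y by (auto intro!: subspace_scale simp del: scaleR_minus_left)
    then have z: "z \<in> W"
      unfolding z_def using W by (intro subspace_add)
    have left: "ip z w = ip y y * ip x w - ip x y * ip y w" if "w \<in> W" for w
      using that mem x y add[OF mem that] scale[OF x that] scale[OF y that]
      unfolding z_def by (simp del: scaleR_minus_left)
    have "ip z z = ip y y * ip z x - ip x y * ip z y"
      using left[OF z] comm[OF x z] comm[OF y z] by simp
    also have "\<dots> = ip y y * (ip x x * ip y y - (ip x y)\<^sup>2)"
      by (simp only: left[OF x] left[OF y] comm[OF y x]) (simp add: power2_eq_square algebra_simps)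
    finally have "0 \<le> ip y y * (ip x x * ip y y - (ip x y)\<^sup>2)"
      using inner_product_on_ge_zero[OF ip z] by simp
    with pos[OF y False] show ?thesis
      by (simp add: zero_le_mult_iff)
  qed
qed

lemma euclidean_norm_on_ge_zero:
  assumes "euclidean_norm_on W N" "x \<in> W"
  shows "N x \<ge> 0"
  using assms inner_product_on_ge_zero unfolding euclidean_norm_on_def by fastforce

lemma euclidean_norm_on_triangle:
  assumes "euclidean_norm_on W N" "subspace W" "x \<in> W" "y \<in> W"
  shows "N (x + y) \<le> N x + N y"
proof -
  obtain ip where ip: "inner_product_on W ip" and N: "\<And>u. u \<in> W \<Longrightarrow> N u = sqrt (ip u u)"
    using assms(1) unfolding euclidean_norm_on_def by blast
  have xy: "x + y \<in> W"
    using assms by (intro subspace_add)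
  have pos: "ip x x \<ge> 0" "ip y y \<ge> 0"
    using inner_product_on_ge_zero[OF ip] assms by auto
  note comm = inner_product_on_commute[OF ip] and add = inner_product_on_add_left[OF ip]
  have "ip (x + y) (x + y) = ip x x + 2 * ip x y + ip y y"
    using add[OF assms(3,4) xy] add[OF assms(3,4,3)] add[OF assms(3,4,4)]
      comm[OF assms(3) xy] comm[OF assms(4) xy] comm[OF assms(3,4)] by simp
  also have "\<dots> \<le> ip x x + 2 * sqrt (ip x x * ip y y) + ip y y"
    using real_le_rsqrt[OF inner_product_on_Cauchy_Schwarz[OF ip assms(2-4)]] by simp
  also have "\<dots> = (sqrt (ip x x) + sqrt (ip y y))\<^sup>2"
    using pos by (simp add: power2_sum real_sqrt_mult)
  finally show ?thesis
    using pos N assms xy by (simp add: real_le_lsqrt)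
qed

section \<open>Minkowski's inequality and sums of mixed powers\<close>

lemma convex_on_power_nonneg: "convex_on {0::real..} (\<lambda>x. x ^ n)"
  by (cases "even n") (auto intro: convex_power_odd convex_on_subset[OF convex_power_even])

text \<open>With \<open>A\<close> and \<open>B\<close> the \<open>l\<^sup>p\<close> norms of \<open>f\<close> and \<open>g\<close>, the quotient \<open>(f i + g i) / (A + B)\<close> is the
  convex combination of \<open>f i / A\<close> and \<open>g i / B\<close> with weights \<open>A / (A + B)\<close> and \<open>B / (A + B)\<close>.
  Convexity of the \<open>p\<close>-th power bounds the sum of the \<open>p\<close>-th powers of these
  quotients by the total weight \<open>1\<close>.\<close>

lemma Minkowski_inequality_sum:
  fixes f g :: "'i \<Rightarrow> real"
  assumes fin: "finite I" and p: "p > 0"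
    and f: "\<And>i. i \<in> I \<Longrightarrow> f i \<ge> 0" and g: "\<And>i. i \<in> I \<Longrightarrow> g i \<ge> 0"
  shows "root p (\<Sum>i\<in>I. (f i + g i) ^ p) \<le> root p (\<Sum>i\<in>I. f i ^ p) + root p (\<Sum>i\<in>I. g i ^ p)"
proof -
  define A where "A = root p (\<Sum>i\<in>I. f i ^ p)"
  define B where "B = root p (\<Sum>i\<in>I. g i ^ p)"
  have Sf: "(\<Sum>i\<in>I. f i ^ p) \<ge> 0" and Sg: "(\<Sum>i\<in>I. g i ^ p) \<ge> 0"
    using f g by (auto intro: sum_nonneg)
  have A: "A \<ge> 0" "A ^ p = (\<Sum>i\<in>I. f i ^ p)" and B: "B \<ge> 0" "B ^ p = (\<Sum>i\<in>I. g i ^ p)"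
    using Sf Sg p by (simp_all add: A_def B_def)
  consider "A = 0" | "B = 0" | "A > 0" "B > 0"
    using A B by linarith
  then have "root p (\<Sum>i\<in>I. (f i + g i) ^ p) \<le> A + B"
  proof cases
    case 1
    then have "\<forall>i\<in>I. f i = 0"
      using A(2) p f fin by (simp add: sum_nonneg_eq_0_iff power_0_left)
    then show ?thesis using A(1) by (simp add: B_def)
  next
    case 2
    then have "\<forall>i\<in>I. g i = 0"
      using B(2) p g fin by (simp add: sum_nonneg_eq_0_iff power_0_left)
    then show ?thesis using B(1) by (simp add: A_def)
  next
    case 3
    have "((f i + g i) / (A + B)) ^ p \<le> A / (A + B) * (f i / A) ^ p + B / (A + B) * (g i / B) ^ p"
      if "i \<in> I" for i
    proof -
      have "1 - B / (A + B) = A / (A + B)"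
        using 3 by (simp add: field_simps)
      moreover have "A / (A + B) * (f i / A) + B / (A + B) * (g i / B) = (f i + g i) / (A + B)"
        using 3 by (simp add: add_divide_distrib)
      ultimately show ?thesis
        using convex_onD[OF convex_on_power_nonneg, of "B / (A + B)" "f i / A" "g i / B" p]
          3 f[OF that] g[OF that] by simp
    qed
    then have "(\<Sum>i\<in>I. ((f i + g i) / (A + B)) ^ p)
        \<le> (\<Sum>i\<in>I. A / (A + B) * (f i / A) ^ p + B / (A + B) * (g i / B) ^ p)"
      by (rule sum_mono)
    also have "\<dots> = A / (A + B) * ((\<Sum>i\<in>I. f i ^ p) / A ^ p) + B / (A + B) * ((\<Sum>i\<in>I. g i ^ p) / B ^ p)"
      by (simp only: sum.distrib sum_distrib_left sum_divide_distrib power_divide)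
    also have "\<dots> = A / (A + B) + B / (A + B)"
      using 3 by (simp flip: A(2) B(2))
    also have "\<dots> = 1"
      using 3 by (simp flip: add_divide_distrib)
    finally have "(\<Sum>i\<in>I. (f i + g i) ^ p) / (A + B) ^ p \<le> 1"
      by (simp add: power_divide sum_divide_distrib)
    then have "(\<Sum>i\<in>I. (f i + g i) ^ p) \<le> (A + B) ^ p"
      using 3 by (simp add: divide_le_eq)
    then have "root p (\<Sum>i\<in>I. (f i + g i) ^ p) \<le> root p ((A + B) ^ p)"
      using p by (rule real_root_le_mono[rotated])
    also have "\<dots> = A + B"
      using 3 p by (simp add: real_root_power_cancel)
    finally show ?thesis .
  qed
  then show ?thesis by (simp add: A_def B_def)
qed

text \<open>Unless \<open>a = b = 0\<close>, homogeneity reduces the claim to \<open>a + b = 1\<close>. There \<open>t ^ n \<ge> t ^ r\<close> for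
  \<open>t \<in> [0,1]\<close>, so the two roots on the right are at least \<open>a\<close> and \<open>b\<close>.\<close>

lemma root_power_add_le:
  fixes a b :: real
  assumes n: "n \<le> r" and r: "r > 0" and a: "a \<ge> 0" and b: "b \<ge> 0"
  shows "root r ((a + b) ^ n) \<le> root r (a ^ n) + root r (b ^ n)"
proof (cases "a + b = 0")
  case True
  then have "a = 0" "b = 0" using a b by auto
  with r show ?thesis by (cases "n = 0") simp_all
next
  case False
  define s where "s = a + b"
  have s: "s > 0" using False a b by (simp add: s_def)
  have le: "t / s \<le> root r ((t / s) ^ n)" if "0 \<le> t" "t \<le> s" for t
  proof -
    have "root r ((t / s) ^ r) \<le> root r ((t / s) ^ n)"
      using that s n r by (intro real_root_le_mono power_decreasing) auto
    then show ?thesis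
      using that s r by (simp add: real_root_power_cancel)
  qed
  have "1 = a / s + b / s"
    using s by (simp add: s_def flip: add_divide_distrib)
  also have "\<dots> \<le> root r ((a / s) ^ n) + root r ((b / s) ^ n)"
    using le[of a] le[of b] a b by (simp add: s_def)
  also have "\<dots> = (root r (a ^ n) + root r (b ^ n)) / root r (s ^ n)"
    by (simp only: power_divide real_root_divide add_divide_distrib)
  finally show ?thesis
    using s r by (simp add: s_def le_divide_eq)
qed

text \<open>Taking \<open>r\<close>-th roots of \<open>t ^ m i\<close> makes all exponents equal to \<open>2 * r\<close>. The hypothesis
  \<open>m i \<le> r\<close> keeps this substitution subadditive, so Minkowski's inequality applies to
  the substituted values.\<close>

lemma root_sum_power_add_le:
  fixes a b :: "'i \<Rightarrow> real"
  assumes fin: "finite I" and r: "r > 0" and m: "\<And>i. i \<in> I \<Longrightarrow> m i \<le> r"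
    and a: "\<And>i. i \<in> I \<Longrightarrow> a i \<ge> 0" and b: "\<And>i. i \<in> I \<Longrightarrow> b i \<ge> 0"
  shows "root (2 * r) (\<Sum>i\<in>I. (a i + b i) ^ (2 * m i))
    \<le> root (2 * r) (\<Sum>i\<in>I. a i ^ (2 * m i)) + root (2 * r) (\<Sum>i\<in>I. b i ^ (2 * m i))"
proof -
  define u where "u t i = root r (t ^ m i)" for t :: real and i
  have u_nonneg: "u t i \<ge> 0" if "t \<ge> 0" for t i
    using that r by (simp add: u_def)
  have u_power: "u t i ^ (2 * r) = t ^ (2 * m i)" if "t \<ge> 0" for t i
  proof -
    have "u t i ^ (2 * r) = (u t i ^ r)\<^sup>2"
      by (simp add: power_mult[symmetric] mult.commute)
    also have "u t i ^ r = t ^ m i"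
      using that r by (simp add: u_def)
    finally show ?thesis
      by (simp add: power_mult[symmetric] mult.commute)
  qed
  have "(\<Sum>i\<in>I. (a i + b i) ^ (2 * m i)) = (\<Sum>i\<in>I. u (a i + b i) i ^ (2 * r))"
    using a b by (intro sum.cong) (simp_all add: u_power)
  also have "\<dots> \<le> (\<Sum>i\<in>I. (u (a i) i + u (b i) i) ^ (2 * r))"
    using a b m r root_power_add_le
    by (intro sum_mono power_mono u_nonneg) (auto simp: u_def)
  finally have "root (2 * r) (\<Sum>i\<in>I. (a i + b i) ^ (2 * m i))
      \<le> root (2 * r) (\<Sum>i\<in>I. (u (a i) i + u (b i) i) ^ (2 * r))"
    using r by simp
  also have "\<dots> \<le> root (2 * r) (\<Sum>i\<in>I. u (a i) i ^ (2 * r)) + root (2 * r) (\<Sum>i\<in>I. u (b i) i ^ (2 * r))"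
    using fin r a b u_nonneg by (intro Minkowski_inequality_sum) auto
  also have "\<dots> = root (2 * r) (\<Sum>i\<in>I. a i ^ (2 * m i)) + root (2 * r) (\<Sum>i\<in>I. b i ^ (2 * m i))"
    using a b by (simp add: u_power cong: sum.cong)
  finally show ?thesis .
qed

section \<open>Components in an internal direct sum\<close>

lemma component_PiE_sum:
  assumes "internal_direct_sum r V"
  shows "component r V x \<in> Pi\<^sub>E {1..r} V" "x = (\<Sum>i=1..r. component r V x i)"
proof -
  have "\<exists>!v. v \<in> Pi\<^sub>E {1..r} V \<and> x = (\<Sum>i=1..r. v i)"
    using assms unfolding internal_direct_sum_def by blast
  from theI'[OF this]
  show "component r V x \<in> Pi\<^sub>E {1..r} V" "x = (\<Sum>i=1..r. component r V x i)"
    unfolding component_def by blast+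
qed

lemma component_add:
  assumes ds: "internal_direct_sum r V" and i: "i \<in> {1..r}"
  shows "component r V (x + y) i = component r V x i + component r V y i"
proof -
  define v where "v = restrict (\<lambda>i. component r V x i + component r V y i) {1..r}"
  have "component r V x j + component r V y j \<in> V j" if "j \<in> {1..r}" for j
    using that ds PiE_mem[OF component_PiE_sum(1)[OF ds] that]
    by (auto simp: internal_direct_sum_def intro!: subspace_add)
  then have "v \<in> Pi\<^sub>E {1..r} V"
    by (auto simp: v_def)
  moreover have "(\<Sum>i=1..r. v i) = x + y"
    using component_PiE_sum(2)[OF ds, of x] component_PiE_sum(2)[OF ds, of y]
    by (simp add: v_def sum.distrib)
  ultimately have "component r V (x + y) = v"
    using component_eqI[OF ds] by metis
  with i show ?thesis by (simp add: v_def)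
qed

section \<open>The triangle inequality for the graded norm\<close>

theorem theorem1:
  fixes bracket :: "'a::real_vector \<Rightarrow> 'a \<Rightarrow> 'a"
    and r :: nat
    and V :: "nat \<Rightarrow> 'a set"
    and N :: "nat \<Rightarrow> 'a \<Rightarrow> real"
    and X Y :: 'a
  assumes "r \<ge> 1"
    and "graded_lie_algebra bracket r V"
    and "\<And>i. i \<in> {1..r} \<Longrightarrow> euclidean_norm_on (V i) (N i)"
  shows "graded_norm r V N (X + Y) \<le> graded_norm r V N X + graded_norm r V N Y"
proof -
  let ?c = "component r V"
  have ds: "internal_direct_sum r V"
    using assms(2) by (rule graded_lie_algebra.direct_sum)
  have mem: "?c x i \<in> V i" if "i \<in> {1..r}" for x i
    using component_PiE_sum(1)[OF ds] that by (rule PiE_mem)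
  have nonneg: "N i (?c x i) \<ge> 0" if "i \<in> {1..r}" for x i
    using euclidean_norm_on_ge_zero assms(3) mem that by blast
  have triangle: "N i (?c (X + Y) i) \<le> N i (?c X i) + N i (?c Y i)" if "i \<in> {1..r}" for i
    using euclidean_norm_on_triangle[OF assms(3)[OF that]] ds mem that
    by (simp add: component_add internal_direct_sum_def)
  have "graded_norm r V N (X + Y)
      \<le> root (2 * r) (\<Sum>i=1..r. (N i (?c X i) + N i (?c Y i)) ^ (2 * (r - i + 1)))"
    unfolding graded_norm_def using assms(1) nonneg triangle
    by (intro real_root_le_mono sum_mono power_mono) auto
  also have "\<dots> \<le> graded_norm r V N X + graded_norm r V N Y"
    unfolding graded_norm_def using assms(1) nonneg
    by (intro root_sum_power_add_le) auto
  finally show ?thesis .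
qed

end
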